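(* Let $\alpha,\beta\in(0,1]$, $\lambda,\mu>0$, and let $(S_k)_{k\ge1}$ be the sequence of service times of the fast renewal Mittag-Leffler queue ${}_2Q$ with orders $\alpha,\beta$ and rates $\lambda,\mu$. Then, for every $k\ge1$ and $t>0$, $$\mathbb{P}(S_k>t)=\sum_{j=0}^{+\infty}\bigl(1-F^{\ast(j+1)}(t)\bigr)p^j(1-p).$$
   Context: $E_\alpha(x)=\sum_{k\ge0} x^k/\Gamma(\alpha k+1)$ is the Mittag-Leffler function; $X\sim\mathsf{ML}_\alpha(\lambda)$ means $X\ge0$ and $\mathbb{P}(X>t)=E_\alpha(-\lambda t^\alpha)$ for $t\ge 0$. Set $F(t)=1-E_\alpha(-\lambda t^\alpha)E_\beta(-\mu t^\beta)$, $F^{\ast 1}=F$ and $F^{\ast k}(t)=\int_0^t F^{\ast(k-1)}(t-s)\,dF(s)$. Let $p=\mathbb{P}(X^{(1)}<X^{(2)})$ with $X^{(1)}\sim \mathsf{ML}_\alpha(\lambda)$ and $X^{(2)}\sim\mathsf{ML}_\beta(\mu)$ independent. The fast renewal Mittag-Leffler queue: let $q=(q_k)_{k\ge0}$ be the Markov chain on the non-negative integers with $q_0=0$ and transition probabilities $0\to1$ with probability $1$, and, for $i\ge1$, $i\to i+1$ with probability $p$ and $i\to i-1$ with probability $1-p$. Let $(Y_k)_{k\ge1}$ be i.i.d. with distribution function $F$, independent of $q$, and $\widetilde N(t)=\max\{k\ge0:\sum_{j=1}^kY_j\le t\}$. The queue length process is ${}_2Q(t)=q_{\widetilde N(t)}$.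 Arrival and departure times: $A_0=D_0=0$, $A_n=\min\{t>A_{n-1}:{}_2Q(t)={}_2Q(t-)+1\}$, $D_n=\min\{t>D_{n-1}:{}_2Q(t)={}_2Q(t-)-1\}$ for $n\ge1$. Service times: $S_n=D_n-\max\{D_{n-1},A_n\}$. *)

theory Defs
  imports "HOL-Probability.Probability"
begin

definition mittag_leffler :: "real \<Rightarrow> real \<Rightarrow> real" where
  "mittag_leffler \<alpha> x = (\<Sum>k. x ^ k / Gamma (\<alpha> * real k + 1))"

definition mittag_leffler_distributed :: "'a measure \<Rightarrow> ('a \<Rightarrow> real) \<Rightarrow> real \<Rightarrow> real \<Rightarrow> bool" where
  "mittag_leffler_distributed M X \<alpha> lam \<longleftrightarrow>
     X \<in> borel_measurable M \<and> (AE \<omega> in M. 0 \<le> X \<omega>) \<and>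
     (\<forall>t\<ge>0. measure M {\<omega> \<in> space M. X \<omega> > t} = mittag_leffler \<alpha> (- lam * t powr \<alpha>))"

definition min_mittag_leffler_cdf :: "real \<Rightarrow> real \<Rightarrow> real \<Rightarrow> real \<Rightarrow> real \<Rightarrow> real" where
  "min_mittag_leffler_cdf \<alpha> \<beta> lam \<mu> t =
     (if t < 0 then 0
      else 1 - mittag_leffler \<alpha> (- lam * t powr \<alpha>) * mittag_leffler \<beta> (- \<mu> * t powr \<beta>))"

(* conv_pow G k is the k-fold Lebesgue-Stieltjes convolution of G with itself.  The 0-th power
   is the distribution function of the unit mass at 0; only k >= 1 is needed. *)
fun conv_pow :: "(real \<Rightarrow> real) \<Rightarrow> nat \<Rightarrow> real \<Rightarrow> real" where
  "conv_pow G 0 t = (if t < 0 then 0 else 1)"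
| "conv_pow G (Suc 0) t = G t"
| "conv_pow G (Suc (Suc k)) t =
     (LINT s:{0..t}|interval_measure G. conv_pow G (Suc k) (t - s))"

definition queue_kernel :: "real \<Rightarrow> nat \<Rightarrow> nat \<Rightarrow> real" where
  "queue_kernel p i j =
     (if i = 0 then (if j = 1 then 1 else 0)
      else if j = i + 1 then p
      else if j = i - 1 then 1 - p
      else 0)"

definition markov_chain_on_nat ::
  "'a measure \<Rightarrow> (nat \<Rightarrow> 'a \<Rightarrow> nat) \<Rightarrow> nat \<Rightarrow> (nat \<Rightarrow> nat \<Rightarrow> real) \<Rightarrow> bool" where
  "markov_chain_on_nat M q x0 K \<longleftrightarrow>
     (\<forall>n. q n \<in> measurable M (count_space UNIV)) \<and>
     (AE \<omega> in M. q 0 \<omega> = x0) \<and>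
     (\<forall>n x j. measure M {\<omega> \<in> space M. \<forall>i\<le>n. q i \<omega> = x i} > 0 \<longrightarrow>
        \<P>(\<omega> in M. q (Suc n) \<omega> = j \<bar> \<forall>i\<le>n. q i \<omega> = x i) = K (x n) j)"

(* Sequences of variables with index from 1; Y 0 plays no role. *)
definition iid_with_cdf :: "'a measure \<Rightarrow> (nat \<Rightarrow> 'a \<Rightarrow> real) \<Rightarrow> (real \<Rightarrow> real) \<Rightarrow> bool" where
  "iid_with_cdf M Y G \<longleftrightarrow>
     prob_space.indep_vars M (\<lambda>_. borel) Y {1..} \<and>
     (\<forall>k\<ge>1. \<forall>t. measure M {\<omega> \<in> space M. Y k \<omega> \<le> t} = G t)"

(* Independence of the sigma-algebras generated by the two whole processes.  The library's
   indep_var needs both variables to have the same type, hence the detour. *)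
definition indep_processes ::
  "'a measure \<Rightarrow> (nat \<Rightarrow> 'a \<Rightarrow> nat) \<Rightarrow> (nat \<Rightarrow> 'a \<Rightarrow> real) \<Rightarrow> bool" where
  "indep_processes M q Y \<longleftrightarrow>
     prob_space.indep_set M
       (sets (vimage_algebra (space M) (\<lambda>\<omega> k. q k \<omega>) (PiM UNIV (\<lambda>_. count_space UNIV))))
       (sets (vimage_algebra (space M) (\<lambda>\<omega>. \<lambda>k\<in>{1..}. Y k \<omega>) (PiM {1..} (\<lambda>_. borel))))"

(* The definitions below are pathwise.  GREATEST and LEAST are the literal maximum and minimum;
   on the null set of paths where one of these or a left limit does not exist, the value is
   unspecified. *)

definition renewal_count :: "(nat \<Rightarrow> real) \<Rightarrow> real \<Rightarrow> nat" where
  "renewal_count y t = (GREATEST k. (\<Sum>j=1..k. y j) \<le> t)"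

definition queue_length :: "(nat \<Rightarrow> nat) \<Rightarrow> (nat \<Rightarrow> real) \<Rightarrow> real \<Rightarrow> nat" where
  "queue_length x y t = x (renewal_count y t)"

definition left_lim :: "(real \<Rightarrow> nat) \<Rightarrow> real \<Rightarrow> nat" where
  "left_lim Q t = Lim (at_left t) Q"

primrec arrival_time :: "(real \<Rightarrow> nat) \<Rightarrow> nat \<Rightarrow> real" where
  "arrival_time Q 0 = 0"
| "arrival_time Q (Suc n) =
     (LEAST t. t > arrival_time Q n \<and> int (Q t) = int (left_lim Q t) + 1)"

primrec departure_time :: "(real \<Rightarrow> nat) \<Rightarrow> nat \<Rightarrow> real" where
  "departure_time Q 0 = 0"
| "departure_time Q (Suc n) =
     (LEAST t. t > departure_time Q n \<and> int (Q t) = int (left_lim Q t) - 1)"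

definition service_time :: "(real \<Rightarrow> nat) \<Rightarrow> nat \<Rightarrow> real" where
  "service_time Q n = departure_time Q n - max (departure_time Q (n - 1)) (arrival_time Q n)"

(* The event {S_k > t}.  Because of the unspecified values on a null set it is only known to be
   measurable up to a null set, so its probability is to be taken in completion M, which agrees
   with M on the sets measurable in M. *)
definition service_time_exceeds ::
  "'a measure \<Rightarrow> (nat \<Rightarrow> 'a \<Rightarrow> nat) \<Rightarrow> (nat \<Rightarrow> 'a \<Rightarrow> real) \<Rightarrow> nat \<Rightarrow> real \<Rightarrow> 'a set" where
  "service_time_exceeds M q Y k t =
     {\<omega> \<in> space M. service_time (queue_length (\<lambda>i. q i \<omega>) (\<lambda>j. Y j \<omega>)) k > t}"

end

theory Submission
  imports Defs
begin

text \<open>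
  Let \<open>T\<^sub>k = Y\<^sub>1 + \<dots> + Y\<^sub>k\<close>. Almost surely all \<open>Y\<^sub>k\<close> are positive, so the queue length equals \<open>q\<^sub>k\<close>
  on \<open>[T\<^sub>k, T\<^sub>k\<^sub>+\<^sub>1)\<close>, and the arrival and departure times are \<open>T\<close> evaluated at the up and down steps of \<open>q\<close>.
  The service of a customer therefore starts at \<open>T\<^sub>m\<close>, where \<open>m\<close> is a stopping time of \<open>q\<close> with \<open>q\<^sub>m \<ge> 1\<close>,
  and ends at \<open>T\<^sub>m\<^sub>+\<^sub>j\<^sub>+\<^sub>1\<close>, where \<open>j\<close> is the number of up steps before the next down step.
  By the Markov property \<open>j\<close> is geometric with parameter \<open>1 - p\<close>, whatever \<open>m\<close> is. Conditionally on
  \<open>m\<close> and \<open>j\<close> the service time is a sum of \<open>j + 1\<close> independent variables with distribution function \<open>F\<close>.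
  Every service ends because \<open>p < 1\<close>, which follows from the behaviour of the Mittag-Leffler functions near \<open>0\<close>.
\<close>

section \<open>Jump times of a path\<close>

primrec jump_count :: "(nat \<Rightarrow> bool) \<Rightarrow> nat \<Rightarrow> nat" where
  "jump_count J 0 = 0"
| "jump_count J (Suc m) = jump_count J m + of_bool (J (Suc m))"

text \<open>With fewer than \<open>n\<close> jumps the \<open>LEAST\<close> is unspecified, so facts
  about it carry a witness \<open>m\<close> with \<open>n \<le> jump_count J m\<close>.\<close>

definition jump_index :: "(nat \<Rightarrow> bool) \<Rightarrow> nat \<Rightarrow> nat" where
  "jump_index J n = (LEAST m. n \<le> jump_count J m)"

lemma jump_count_mono: "i \<le> j \<Longrightarrow> jump_count J i \<le> jump_count J j"
  by (induction j) (auto simp: le_Suc_eq)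

lemma jump_count_cong:
  "(\<And>i. 1 \<le> i \<Longrightarrow> i \<le> m \<Longrightarrow> J i = J' i) \<Longrightarrow> jump_count J m = jump_count J' m"
  by (induction m) auto

lemma jump_index_le: "n \<le> jump_count J m \<Longrightarrow> jump_index J n \<le> m"
  unfolding jump_index_def by (rule Least_le)

lemma jump_index_ge:
  assumes "n \<le> jump_count J m"
  shows "n \<le> jump_count J (jump_index J n)"
  unfolding jump_index_def using assms by (rule LeastI)

lemma jump_index_0 [simp]: "jump_index J 0 = 0"
  using jump_index_le[of 0 J 0] by simp

text \<open>The counter grows by at most one per step: just before the first index that reaches
  \<open>Suc n\<close> it is still at least \<open>n\<close>, and that index must be a jump.\<close>

lemma jump_index_Suc:
  assumes "Suc n \<le> jump_count J m"
  shows "jump_index J n < jump_index J (Suc n)" (is ?less)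
    and "J (jump_index J (Suc n))" (is ?jump)
proof -
  define l where "l = jump_index J (Suc n)"
  have l: "Suc n \<le> jump_count J l"
    unfolding l_def by (rule jump_index_ge[OF assms])
  then obtain l' where l': "l = Suc l'"
    by (cases l) auto
  have "\<not> Suc n \<le> jump_count J l'"
    using jump_index_le[of "Suc n" J l'] l' l_def by auto
  with l have "J l" "n \<le> jump_count J l'"
    by (auto simp: l' of_bool_def split: if_splits)
  with jump_index_le[of n J l'] have "jump_index J n < l" "J l"
    by (auto simp: l')
  then show ?less ?jump
    by (simp_all add: l_def)
qed

section \<open>Queue paths driven by positive steps\<close>

definition renewal_time :: "(nat \<Rightarrow> real) \<Rightarrow> nat \<Rightarrow> real" where
  "renewal_time y k = (\<Sum>j=1..k. y j)"

lemma renewal_time_0 [simp]: "renewal_time y 0 = 0"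
  by (simp add: renewal_time_def)

lemma renewal_time_Suc: "renewal_time y (Suc k) = renewal_time y k + y (Suc k)"
  by (simp add: renewal_time_def)

lemma renewal_time_add:
  "renewal_time y (m + k) - renewal_time y m = (\<Sum>j=m+1..m+k. y j)"
  by (induction k) (auto simp: renewal_time_Suc)

locale positive_steps =
  fixes y :: "nat \<Rightarrow> real"
  assumes y_pos: "1 \<le> j \<Longrightarrow> 0 < y j"
begin

abbreviation T :: "nat \<Rightarrow> real" where
  "T \<equiv> renewal_time y"

lemma strict_mono_T: "strict_mono T"
  using y_pos by (intro strict_monoI_Suc) (simp add: renewal_time_Suc)

lemma T_less_iff [simp]: "T i < T j \<longleftrightarrow> i < j"
  using strict_mono_T by (rule strict_mono_less)

lemma T_le_iff [simp]: "T i \<le> T j \<longleftrightarrow> i \<le> j"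
  using strict_mono_T by (rule strict_mono_less_eq)

lemma max_T: "max (T i) (T j) = T (max i j)"
  by (simp add: max_def)

lemma renewal_count_eq:
  assumes "T k \<le> t" "t < T (Suc k)"
  shows "renewal_count y t = k"
  unfolding renewal_count_def renewal_time_def[symmetric]
proof (rule Greatest_equality)
  fix i assume "T i \<le> t"
  with assms(2) have "T i < T (Suc k)" by linarith
  then show "i \<le> k" by simp
qed (rule assms)

text \<open>The path is constant on \<open>(T k, t)\<close> even when \<open>t\<close> is itself the
  next renewal time; hence the interval is closed on the right.\<close>

lemma left_lim_eq:
  assumes "T k < t" "t \<le> T (Suc k)"
  shows "left_lim (queue_length x y) t = x k"
  unfolding left_lim_def
proof (rule tendsto_Lim)
  have "\<forall>\<^sub>F s in at_left t. T k < s \<and> s < t"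
    using assms(1) by (auto simp: eventually_at_left_field intro!: exI[of _ "T k"])
  then have "\<forall>\<^sub>F s in at_left t. queue_length x y s = x k"
    by eventually_elim (use assms(2) in \<open>auto simp: queue_length_def intro!: arg_cong[of _ _ x] renewal_count_eq\<close>)
  then show "(queue_length x y \<longlongrightarrow> x k) (at_left t)"
    by (rule tendsto_eventually)
qed simp

text \<open>For general positive \<open>y\<close> the renewal times may accumulate; the bound
  \<open>t \<le> T m\<close> keeps \<open>t\<close> in the range that they cover.\<close>

lemma obtain_interval:
  assumes "0 < t" "t \<le> T m"
  obtains k where "T k < t" "t \<le> T (Suc k)"
proof -
  define l where "l = (LEAST i. t \<le> T i)"
  have l: "t \<le> T l"
    unfolding l_def using assms(2) by (rule LeastI)
  with assms(1) obtain k where k: "l = Suc k"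
    by (cases l) auto
  have "\<not> t \<le> T k"
    using not_less_Least[of k "\<lambda>i. t \<le> T i"] k l_def by auto
  with l k show ?thesis by (intro that) auto
qed

text \<open>\<open>R\<close> stands for either direction of a jump, so that arrivals and departures
  share one argument. Between renewal times the path equals its left limit, and irreflexivity of
  \<open>R\<close> excludes a jump there.\<close>

lemma jump_iff:
  assumes irrefl: "\<And>n. \<not> R n n" and "0 < t" "t \<le> T m"
  shows "R (queue_length x y t) (left_lim (queue_length x y) t) \<longleftrightarrow>
    (\<exists>i\<ge>1. t = T i \<and> R (x i) (x (i - 1)))"
proof -
  obtain k where k: "T k < t" "t \<le> T (Suc k)"
    using obtain_interval assms(2,3) by blast
  show ?thesis
  proof (cases "t = T (Suc k)")
    case True
    have "queue_length x y t = x (Suc k)"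
      unfolding queue_length_def True
      by (rule arg_cong[of _ _ x], rule renewal_count_eq) (simp_all only: T_le_iff T_less_iff)
    moreover have "T (Suc k) = T i \<longleftrightarrow> i = Suc k" for i
      using strict_mono_eq[OF strict_mono_T, of "Suc k" i] by auto
    then have "(\<exists>i\<ge>1. t = T i \<and> R (x i) (x (i - 1))) \<longleftrightarrow> R (x (Suc k)) (x k)"
      unfolding True by simp
    ultimately show ?thesis
      using left_lim_eq[OF k, of x] by simp
  next
    case False
    with k have "queue_length x y t = x k"
      unfolding queue_length_def
      by (intro arg_cong[of _ _ x] renewal_count_eq) auto
    moreover have "t \<noteq> T i" for i
    proof
      assume "t = T i"
      with k False have "T k < T i" "T i < T (Suc k)" by linarith+
      then show False unfolding T_less_iff by simp
    qed
    ultimately show ?thesis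
      using left_lim_eq[OF k] irrefl by auto
  qed
qed

text \<open>The recursion for \<open>S\<close> is the common shape of \<open>arrival_time\<close>
  and \<open>departure_time\<close>. As the \<open>n\<close>-th jump exists, each
  \<open>LEAST\<close> over the reals involved is an attained minimum.\<close>

lemma jump_time_eq:
  fixes S :: "nat \<Rightarrow> real"
  assumes irrefl: "\<And>n. \<not> R n n"
    and S_0: "S 0 = 0"
    and S_Suc: "\<And>n. S (Suc n) =
      (LEAST t. t > S n \<and> R (queue_length x y t) (left_lim (queue_length x y) t))"
    and J: "J = (\<lambda>i. R (x i) (x (i - 1)))"
    and "n \<le> jump_count J m"
  shows "S n = T (jump_index J n)"
  using assms(5)
proof (induction n)
  case 0
  then show ?case by (simp add: S_0)
next
  case (Suc n)
  note IH = Suc.IH[OF Suc_leD[OF Suc.prems]]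
  let ?l = "jump_index J (Suc n)"
  note l = jump_index_Suc[OF Suc.prems]
  have iff: "R (queue_length x y t) (left_lim (queue_length x y) t) \<longleftrightarrow>
      (\<exists>i\<ge>1. t = T i \<and> J i)" if "T (jump_index J n) < t" "t \<le> T ?l" for t
  proof -
    have "T 0 \<le> T (jump_index J n)"
      by (simp only: T_le_iff)
    with that have "0 < t" by simp
    then show ?thesis
      unfolding J by (rule jump_iff[of R t ?l x, OF irrefl]) (use that in \<open>simp add: J\<close>)
  qed
  show ?case
    unfolding S_Suc IH
  proof (rule Least_equality)
    show "T (jump_index J n) < T ?l \<and>
        R (queue_length x y (T ?l)) (left_lim (queue_length x y) (T ?l))"
      using l by (subst iff) (auto intro!: exI[of _ ?l])
    fix t assume t: "T (jump_index J n) < t \<and>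
      R (queue_length x y t) (left_lim (queue_length x y) t)"
    \<comment> \<open>A smaller candidate would be \<open>T i\<close> with \<open>J i\<close> and
      \<open>i\<close> beyond the \<open>n\<close>-th jump; the counter would reach
      \<open>Suc n\<close> at \<open>i\<close> already, against the minimality of
      \<open>?l\<close>.\<close>
    show "T ?l \<le> t"
    proof (rule ccontr)
      assume "\<not> T ?l \<le> t"
      with t iff[of t] obtain i where i: "1 \<le> i" "t = T i" "J i" by auto
      then obtain i' where i': "i = Suc i'" by (cases i) auto
      from t i(2) have "jump_index J n < i" by simp
      then have "jump_count J (jump_index J n) \<le> jump_count J i'"
        using i' by (intro jump_count_mono) simp
      with jump_index_ge[OF Suc_leD[OF Suc.prems]] i(3)
      have "Suc n \<le> jump_count J i"
        by (simp add: i')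
      from jump_index_le[OF this] \<open>\<not> T ?l \<le> t\<close> i(2) show False by simp
    qed
  qed
qed

end

section \<open>Service periods\<close>

text \<open>Truncated subtraction makes both \<open>up x 0\<close> and \<open>down x 0\<close>
  false.\<close>

definition up :: "(nat \<Rightarrow> nat) \<Rightarrow> nat \<Rightarrow> bool" where
  "up x i \<longleftrightarrow> x i = Suc (x (i - 1))"

text \<open>Adding on the left instead of subtracting on the right keeps a stay at 0 from counting
  as a departure.\<close>

definition down :: "(nat \<Rightarrow> nat) \<Rightarrow> nat \<Rightarrow> bool" where
  "down x i \<longleftrightarrow> Suc (x i) = x (i - 1)"

lemma up_Suc: "up x (Suc i) \<longleftrightarrow> x (Suc i) = Suc (x i)"
  by (simp add: up_def)

lemma down_Suc: "down x (Suc i) \<longleftrightarrow> Suc (x (Suc i)) = x i"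
  by (simp add: down_def)

definition ready :: "(nat \<Rightarrow> nat) \<Rightarrow> nat \<Rightarrow> nat \<Rightarrow> bool" where
  "ready x n m \<longleftrightarrow> Suc n \<le> jump_count (up x) m \<and> n \<le> jump_count (down x) m"

text \<open>Indices are shifted: step \<open>m\<close> starts the service of customer \<open>n + 1\<close>, which needs \<open>n + 1\<close>
  arrivals but only \<open>n\<close> departures. On paths of the chain the last conjunct is redundant; it is what
  the Markov property needs.\<close>

definition service_start :: "nat \<Rightarrow> nat \<Rightarrow> (nat \<Rightarrow> nat) \<Rightarrow> bool" where
  "service_start n m x \<longleftrightarrow> ready x n m \<and> (\<forall>i<m. \<not> ready x n i) \<and> 1 \<le> x m"

definition ups :: "nat \<Rightarrow> nat \<Rightarrow> (nat \<Rightarrow> nat) \<Rightarrow> bool" where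
  "ups m j x \<longleftrightarrow> (\<forall>i\<in>{m<..m+j}. up x i)"

text \<open>The almost sure properties of the chain, collected so that the path analysis is
  deterministic; \<open>AE_excursion_path\<close> supplies them.\<close>

locale excursion_path =
  fixes x :: "nat \<Rightarrow> nat"
  assumes x_0: "x 0 = 0"
    and step: "up x (Suc i) \<or> down x (Suc i)"
    and down_after: "\<exists>i>m. down x i"
begin

text \<open>Conservation of customers, written as a sum to stay within \<open>nat\<close>.\<close>

lemma balance: "x m + jump_count (down x) m = jump_count (up x) m"
proof (induction m)
  case (Suc m)
  then show ?case using step[of m] by (auto simp: up_Suc down_Suc)
qed (simp add: x_0)

lemma down_unbounded: "\<exists>m. n \<le> jump_count (down x) m"
proof (induction n)
  case (Suc n)
  then obtain m where m: "n \<le> jump_count (down x) m" by blast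
  obtain i where i: "m < i" "down x i" using down_after by blast
  then obtain i' where i': "i = Suc i'" by (cases i) auto
  have "jump_count (down x) m \<le> jump_count (down x) i'"
    using i i' by (intro jump_count_mono) auto
  with m i i' have "Suc n \<le> jump_count (down x) i" by simp
  then show ?case by blast
qed simp

lemma up_unbounded: "\<exists>m. n \<le> jump_count (up x) m"
proof -
  obtain m where "n \<le> jump_count (down x) m" using down_unbounded by blast
  then show ?thesis using balance[of m] by (intro exI[of _ m]) linarith
qed

text \<open>The maximum is the step index counterpart of the maximum of departure and arrival time
  in \<open>service_time\<close>, for customer \<open>n + 1\<close>.\<close>

lemma ready_iff: "ready x n m \<longleftrightarrow> max (jump_index (down x) n) (jump_index (up x) (Suc n)) \<le> m"
proof -
  obtain a b where "n \<le> jump_count (down x) a" "Suc n \<le> jump_count (up x) b"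
    using down_unbounded up_unbounded by blast
  from this[THEN jump_index_ge] show ?thesis
    unfolding ready_def
    using jump_count_mono[of "jump_index (down x) n" m "down x"]
      jump_count_mono[of "jump_index (up x) (Suc n)" m "up x"]
    by (auto intro: jump_index_le)
qed

text \<open>The step at which the service starts is a departure that leaves a nonempty queue or an
  arrival at an empty one, so exactly \<open>n\<close> departures have occurred by then.\<close>

lemma down_count_at_start:
  assumes "m = max (jump_index (down x) n) (jump_index (up x) (Suc n))"
  shows "jump_count (down x) m = n"
proof -
  have ready: "ready x n m" "\<And>i. i < m \<Longrightarrow> \<not> ready x n i"
    unfolding ready_iff using assms by auto
  from ready(1) obtain m' where m': "m = Suc m'"
    by (cases m) (auto simp: ready_def)
  have "\<not> ready x n m'"
    using ready(2) m' by simp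
  with ready(1) balance[of m'] show ?thesis
    using step[of m'] unfolding m' ready_def by (auto simp: up_Suc down_Suc)
qed

lemma service_start_iff:
  "service_start n m x \<longleftrightarrow> m = max (jump_index (down x) n) (jump_index (up x) (Suc n))"
proof
  assume "service_start n m x"
  then show "m = max (jump_index (down x) n) (jump_index (up x) (Suc n))"
    unfolding service_start_def ready_iff
    by (metis linorder_neqE_nat not_less order_refl)
next
  assume m: "m = max (jump_index (down x) n) (jump_index (up x) (Suc n))"
  then have "ready x n m" by (simp add: ready_iff)
  moreover have "\<forall>i<m. \<not> ready x n i"
    unfolding ready_iff using m not_less by blast
  \<comment> \<open>At least \<open>n + 1\<close> arrivals against exactly \<open>n\<close>
    departures leave a customer in the queue.\<close>
  moreover have "1 \<le> x m"
    using down_count_at_start[OF m] balance[of m] \<open>ready x n m\<close> by (simp add: ready_def)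
  ultimately show "service_start n m x"
    unfolding service_start_def by blast
qed

lemma service_period_exists: "\<exists>m j. service_start n m x \<and> ups m j x \<and> down x (Suc (m + j))"
proof -
  define m where "m = max (jump_index (down x) n) (jump_index (up x) (Suc n))"
  define d where "d = (LEAST i. m < i \<and> down x i)"
  have d: "m < d" "down x d"
    using LeastI_ex[OF down_after[of m]] unfolding d_def by auto
  have "up x i" if "m < i" "i < d" for i
    using not_less_Least[of i "\<lambda>i. m < i \<and> down x i"] that step[of "i - 1"]
    unfolding d_def by auto
  then have "ups m (d - Suc m) x"
    using d by (auto simp: ups_def)
  moreover have "down x (Suc (m + (d - Suc m)))"
    using d by simp
  ultimately show ?thesis
    using service_start_iff[of n m] m_def by blast
qed

text \<open>The departure counter is \<open>n\<close> at the start and the up steps do not change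
  it, so the closing down step is departure number \<open>n + 1\<close>.\<close>

lemma jump_index_after_service:
  assumes "service_start n m x" "ups m j x" "down x (Suc (m + j))"
  shows "jump_index (down x) (Suc n) = Suc (m + j)"
proof -
  have "jump_count (down x) (m + i) = n" if "i \<le> j" for i
    using that
  proof (induction i)
    case 0
    then show ?case
      using assms(1) by (simp add: service_start_iff down_count_at_start)
  next
    case (Suc i)
    then have "up x (Suc (m + i))"
      using assms(2) by (auto simp: ups_def)
    then have "\<not> down x (Suc (m + i))"
      by (simp add: up_Suc down_Suc)
    with Suc show ?case by simp
  qed
  then have eq: "jump_count (down x) (m + j) = n" by simp
  with assms(3) have suc: "Suc n \<le> jump_count (down x) (Suc (m + j))" by simp
  have "\<not> jump_index (down x) (Suc n) \<le> m + j"
    using jump_count_mono[of "jump_index (down x) (Suc n)" "m + j" "down x"]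
      jump_index_ge[OF suc] eq by linarith
  with jump_index_le[OF suc] show ?thesis by simp
qed

text \<open>As \<open>T\<close> is increasing it commutes with \<open>max\<close>, so service runs
  from \<open>T m\<close> to \<open>T (m + Suc j)\<close>, and the difference consists of
  \<open>j + 1\<close> consecutive steps.\<close>

lemma service_time_eq:
  assumes "positive_steps y"
    and "service_start n m x" "ups m j x" "down x (Suc (m + j))"
  shows "service_time (queue_length x y) (Suc n) = (\<Sum>i=m+1..m+Suc j. y i)"
proof -
  interpret positive_steps y by fact
  let ?Q = "queue_length x y"
  have arrival: "arrival_time ?Q i = T (jump_index (up x) i)" for i
  proof -
    obtain m where "i \<le> jump_count (up x) m" using up_unbounded by blast
    then show ?thesis
      by (intro jump_time_eq[where R="\<lambda>a b. int a = int b + 1" and m=m and x=x and J="up x"])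
         (auto simp: up_def down_def)
  qed
  have departure: "departure_time ?Q i = T (jump_index (down x) i)" for i
  proof -
    obtain m where "i \<le> jump_count (down x) m" using down_unbounded by blast
    then show ?thesis
      by (intro jump_time_eq[where R="\<lambda>a b. int a = int b - 1" and m=m and x=x and J="down x"])
         (auto simp: up_def down_def)
  qed
  have "service_time ?Q (Suc n) = T (m + Suc j) - T m"
    using assms(2) jump_index_after_service[OF assms(2-4)]
    by (simp del: departure_time.simps arrival_time.simps
        add: service_time_def arrival departure max_T service_start_iff)
  then show ?thesis
    by (simp only: renewal_time_add)
qed

end

section \<open>The up probability is less than one\<close>

text \<open>\<open>Gamma\<close> has a positive minimum on \<open>[1, 2]\<close>, and for
  \<open>x > 2\<close> the functional equation gives \<open>Gamma x \<ge> Gamma (x - 1)\<close>;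
  induction on an integer bound for \<open>x\<close> covers the half-line.\<close>

lemma Gamma_ge_positive_constant:
  obtains c :: real where "c > 0" "\<And>x. x \<ge> 1 \<Longrightarrow> c \<le> Gamma x"
proof -
  have "continuous_on {1..2::real} Gamma"
    by (intro continuous_intros) (auto elim!: nonpos_Ints_cases)
  then obtain z :: real where z: "z \<in> {1..2}" "\<And>x. x \<in> {1..2} \<Longrightarrow> Gamma z \<le> Gamma x"
    using continuous_attains_inf[of "{1..2::real}" Gamma] by auto
  have "Gamma z \<le> Gamma x" if "1 \<le> x" "x \<le> real n + 2" for n x
    using that
  proof (induction n arbitrary: x)
    case 0
    then show ?case using z(2) by simp
  next
    case (Suc n)
    show ?case
    proof (cases "x \<le> 2")
      case True
      with Suc z(2) show ?thesis by simp
    next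
      case False
      then have "Gamma z \<le> Gamma (x - 1)"
        using Suc.prems by (intro Suc.IH) auto
      also have "\<dots> \<le> (x - 1) * Gamma (x - 1)"
        using False by simp
      also have "x - 1 \<notin> \<int>\<^sub>\<le>\<^sub>0"
        using False by (auto dest: nonpos_Ints_nonpos)
      then have "(x - 1) * Gamma (x - 1) = Gamma x"
        using Gamma_plus1[of "x - 1"] by simp
      finally show ?thesis .
    qed
  qed
  moreover have "\<exists>n. x \<le> real n + 2" for x
    using real_arch_simple[of "x - 2"] by (auto simp: algebra_simps)
  ultimately have "Gamma z \<le> Gamma x" if "x \<ge> 1" for x
    using that by blast
  moreover have "Gamma z > 0"
    using z(1) by simp
  ultimately show thesis using that by blast
qed

lemma mittag_leffler_0 [simp]: "mittag_leffler \<alpha> 0 = 1"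
proof -
  have "(\<lambda>k. (1 / Gamma (\<alpha> * real k + 1)) * 0 ^ k) sums (1 / Gamma (\<alpha> * real 0 + 1))"
    by (rule powser_sums_zero)
  then show ?thesis
    unfolding mittag_leffler_def by (simp add: sums_iff)
qed

text \<open>The lower bound on \<open>Gamma\<close> bounds the coefficients, so the series converges
  at \<open>1/2\<close>; that already permits termwise differentiation at 0.\<close>

lemma DERIV_mittag_leffler_0:
  assumes "\<alpha> > 0"
  shows "(mittag_leffler \<alpha> has_real_derivative 1 / Gamma (\<alpha> + 1)) (at 0)"
proof -
  obtain c :: real where c: "c > 0" "\<And>x. x \<ge> 1 \<Longrightarrow> c \<le> Gamma x"
    using Gamma_ge_positive_constant by blast
  define a where "a = (\<lambda>k. 1 / Gamma (\<alpha> * real k + 1))"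
  have bound: "norm (a k * (1/2) ^ k) \<le> 1 / c * (1/2) ^ k" for k
  proof -
    have "\<bar>a k\<bar> \<le> 1 / c"
      unfolding a_def using c(1) c(2)[of "\<alpha> * real k + 1"] assms
      by (simp add: frac_le)
    from divide_right_mono[OF this, of "2 ^ k"] show ?thesis
      by (simp add: abs_mult power_one_over)
  qed
  have "summable (\<lambda>k. a k * (1/2) ^ k)"
    by (rule summable_comparison_test'[where g="\<lambda>k. 1 / c * (1/2) ^ k" and N=0])
       (use bound in \<open>auto intro!: summable_mult summable_geometric\<close>)
  then have "DERIV (\<lambda>x. \<Sum>k. a k * x ^ k) 0 :> (\<Sum>k. diffs a k * 0 ^ k)"
    by (rule termdiffs_strong) simp
  moreover have "(\<Sum>k. diffs a k * 0 ^ k) = 1 / Gamma (\<alpha> + 1)"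
    using powser_sums_zero[of "diffs a"] by (simp add: sums_iff diffs_def a_def)
  moreover have "(\<lambda>x. \<Sum>k. a k * x ^ k) = mittag_leffler \<alpha>"
    by (simp add: a_def mittag_leffler_def fun_eq_iff)
  ultimately show ?thesis by simp
qed

text \<open>The positive derivative at 0 gives the upper bound, continuity the lower one. The lower
  bound will make a tail of \<open>X1\<close> positive, the upper bound a tail of \<open>X2\<close>
  less than one.\<close>

lemma mittag_leffler_near_0:
  assumes "\<alpha> > 0"
  obtains d where "d > 0" "\<And>h. 0 < h \<Longrightarrow> h < d \<Longrightarrow> 0 < mittag_leffler \<alpha> (- h) \<and> mittag_leffler \<alpha> (- h) < 1"
proof -
  note der = DERIV_mittag_leffler_0[OF assms]
  have "0 < 1 / Gamma (\<alpha> + 1)"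
    using assms by simp
  then obtain d where d: "d > 0" "\<And>h. 0 < h \<Longrightarrow> h < d \<Longrightarrow> mittag_leffler \<alpha> (0 - h) < mittag_leffler \<alpha> 0"
    using DERIV_pos_inc_left[OF der] by blast
  have "isCont (mittag_leffler \<alpha>) 0"
    using der by (rule DERIV_isCont)
  then have "\<forall>\<^sub>F x in at 0. 0 < mittag_leffler \<alpha> x"
    unfolding isCont_def by (rule order_tendstoD) simp
  then obtain e where e: "e > 0" "\<And>x. x \<noteq> 0 \<Longrightarrow> \<bar>x\<bar> < e \<Longrightarrow> 0 < mittag_leffler \<alpha> x"
    by (auto simp: eventually_at)
  show thesis
  proof (rule that[of "min d e"])
    fix h assume "0 < h" "h < min d e"
    then show "0 < mittag_leffler \<alpha> (- h) \<and> mittag_leffler \<alpha> (- h) < 1"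
      using d(2)[of h] e(2)[of "- h"] by simp
  qed (use d e in simp)
qed

text \<open>The chosen \<open>s\<close> solves \<open>c * s powr \<gamma> = d / 2\<close>.\<close>

lemma powr_scale_small:
  fixes c \<gamma> d :: real
  assumes "c > 0" "\<gamma> > 0" "d > 0"
  obtains s where "s > 0" "\<And>t. 0 < t \<Longrightarrow> t \<le> s \<Longrightarrow> 0 < c * t powr \<gamma> \<and> c * t powr \<gamma> < d"
proof (rule that[of "(d / (2 * c)) powr (1 / \<gamma>)"])
  fix t :: real assume t: "0 < t" "t \<le> (d / (2 * c)) powr (1 / \<gamma>)"
  then have "t powr \<gamma> \<le> ((d / (2 * c)) powr (1 / \<gamma>)) powr \<gamma>"
    using assms by (intro powr_mono2) auto
  also have "\<dots> = d / (2 * c)"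
    using assms by (simp add: powr_powr)
  finally show "0 < c * t powr \<gamma> \<and> c * t powr \<gamma> < d"
    using assms t(1) by (auto simp: field_simps)
qed (use assms in simp)

text \<open>For small \<open>t > 0\<close> independence gives the event
  \<open>X2 \<le> t < X1\<close> positive probability, and it excludes
  \<open>X1 < X2\<close>.\<close>

lemma mittag_leffler_less_prob:
  assumes "prob_space N" "0 < \<alpha>" "0 < \<beta>" "0 < lam" "0 < \<mu>"
    and X1: "mittag_leffler_distributed N X1 \<alpha> lam"
    and X2: "mittag_leffler_distributed N X2 \<beta> \<mu>"
    and ind: "prob_space.indep_var N borel X1 borel X2"
  shows "measure N {\<omega> \<in> space N. X1 \<omega> < X2 \<omega>} < 1"
proof -
  interpret prob_space N by fact
  obtain d1 where d1: "d1 > 0" "\<And>h. 0 < h \<Longrightarrow> h < d1 \<Longrightarrow> 0 < mittag_leffler \<alpha> (- h) \<and> mittag_leffler \<alpha> (- h) < 1"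
    using mittag_leffler_near_0[OF assms(2)] by blast
  obtain d2 where d2: "d2 > 0" "\<And>h. 0 < h \<Longrightarrow> h < d2 \<Longrightarrow> 0 < mittag_leffler \<beta> (- h) \<and> mittag_leffler \<beta> (- h) < 1"
    using mittag_leffler_near_0[OF assms(3)] by blast
  obtain s1 where s1: "s1 > 0" "\<And>t. 0 < t \<Longrightarrow> t \<le> s1 \<Longrightarrow> 0 < lam * t powr \<alpha> \<and> lam * t powr \<alpha> < d1"
    using powr_scale_small[OF assms(4,2) d1(1)] by blast
  obtain s2 where s2: "s2 > 0" "\<And>t. 0 < t \<Longrightarrow> t \<le> s2 \<Longrightarrow> 0 < \<mu> * t powr \<beta> \<and> \<mu> * t powr \<beta> < d2"
    using powr_scale_small[OF assms(5,3) d2(1)] by blast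
  define t where "t = min s1 s2"
  have t: "0 < t" "t \<le> s1" "t \<le> s2"
    using s1(1) s2(1) by (auto simp: t_def)
  have [measurable]: "X1 \<in> borel_measurable N" "X2 \<in> borel_measurable N"
    using X1 X2 by (auto simp: mittag_leffler_distributed_def)
  have tail1: "0 < prob {\<omega> \<in> space N. X1 \<omega> > t}"
    using X1 t d1(2) s1(2) by (auto simp: mittag_leffler_distributed_def)
  have "prob {\<omega> \<in> space N. X2 \<omega> > t} < 1"
    using X2 t d2(2) s2(2) by (auto simp: mittag_leffler_distributed_def)
  then have tail2: "0 < prob {\<omega> \<in> space N. X2 \<omega> \<le> t}"
    using prob_neg[of "\<lambda>\<omega>. X2 \<omega> > t"] by (simp add: not_less)
  have "prob ((\<lambda>\<omega>. (X1 \<omega>, X2 \<omega>)) -` ({t<..} \<times> {..t}) \<inter> space N) =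
      prob (X1 -` {t<..} \<inter> space N) * prob (X2 -` {..t} \<inter> space N)"
    by (rule indep_varD[OF ind]) auto
  also have "X1 -` {t<..} \<inter> space N = {\<omega> \<in> space N. X1 \<omega> > t}" by auto
  also have "X2 -` {..t} \<inter> space N = {\<omega> \<in> space N. X2 \<omega> \<le> t}" by auto
  also have "(\<lambda>\<omega>. (X1 \<omega>, X2 \<omega>)) -` ({t<..} \<times> {..t}) \<inter> space N =
      {\<omega> \<in> space N. t < X1 \<omega> \<and> X2 \<omega> \<le> t}" by auto
  finally have "0 < prob {\<omega> \<in> space N. t < X1 \<omega> \<and> X2 \<omega> \<le> t}"
    using tail1 tail2 by simp
  also have "\<dots> \<le> prob {\<omega> \<in> space N. \<not> X1 \<omega> < X2 \<omega>}"
    by (rule finite_measure_mono) auto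
  also have "\<dots> = 1 - prob {\<omega> \<in> space N. X1 \<omega> < X2 \<omega>}"
    by (rule prob_neg) measurable
  finally show ?thesis by simp
qed

section \<open>Distribution of partial sums\<close>

text \<open>Turns the integrator of \<open>conv_pow\<close> into the law of a step. The regularity
  of \<open>G\<close> that \<open>interval_measure\<close> requires is inherited from the law of
  \<open>X\<close>.\<close>

lemma (in prob_space) interval_measure_eq_distr:
  fixes X :: "'a \<Rightarrow> real"
  assumes [measurable]: "random_variable borel X"
    and cdf: "\<And>t. prob {\<omega> \<in> space M. X \<omega> \<le> t} = G t"
  shows "interval_measure G = distr M borel X"
proof -
  interpret D: real_distribution "distr M borel X"
    by simp
  have G: "cdf (distr M borel X) = G"
    using cdf by (auto simp: cdf_def measure_distr fun_eq_iff vimage_def Int_def conj_commute)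
  have G_props: "\<And>x y. x \<le> y \<Longrightarrow> G x \<le> G y" "\<And>a. continuous (at_right a) G"
    "(G \<longlongrightarrow> 0) at_bot" "(G \<longlongrightarrow> 1) at_top"
    using D.cdf_nondecreasing D.cdf_is_right_cont D.cdf_lim_at_bot D.cdf_lim_at_top_prob
    unfolding G by auto
  have "real_distribution (interval_measure G)" "cdf (interval_measure G) = G"
    using G_props by (auto intro!: real_distribution_interval_measure cdf_interval_measure)
  then show ?thesis
    by (intro cdf_unique) (auto simp: G D.real_distribution_axioms)
qed

text \<open>Splitting off the last summand \<open>Y l\<close> and integrating over its value
  reproduces the recursion of \<open>conv_pow\<close>. The value does not depend on the offset
  \<open>m\<close>.\<close>

lemma (in prob_space) prob_sum_le_eq_conv_pow:
  fixes Y :: "nat \<Rightarrow> 'a \<Rightarrow> real"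
  assumes ind: "indep_vars (\<lambda>_. borel) Y {1..}"
    and cdf: "\<And>k t. 1 \<le> k \<Longrightarrow> prob {\<omega> \<in> space M. Y k \<omega> \<le> t} = G t"
    and G_0: "G 0 = 0"
    and "0 \<le> t"
  shows "prob {\<omega> \<in> space M. (\<Sum>i=m+1..m+Suc j. Y i \<omega>) \<le> t} = conv_pow G (Suc j) t"
  using assms(4)
proof (induction j arbitrary: t)
  case 0
  then show ?case by (simp add: cdf)
next
  case (Suc j)
  have Y_meas [measurable]: "random_variable borel (Y i)" if "1 \<le> i" for i
    using ind that by (auto simp: indep_vars_def)
  have Y_nonneg: "AE \<omega> in M. 0 < Y i \<omega>" if "1 \<le> i" for i
    using prob_Collect_eq_0[of "\<lambda>\<omega>. Y i \<omega> \<le> 0"] cdf[OF that, of 0] Y_meas[OF that] G_0 by (simp add: not_le)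
  define I where "I = {m+1..m+Suc j}"
  define l where "l = m + Suc (Suc j)"
  define S where "S = (\<lambda>\<omega>. \<Sum>i\<in>I. Y i \<omega>)"
  have I: "finite I" "l \<notin> I" "1 \<le> l" "insert l I \<subseteq> {1..}"
    by (auto simp: I_def l_def)
  have [measurable]: "random_variable borel S" "random_variable borel (Y l)"
    unfolding S_def using I(3) by (auto simp: I_def intro!: borel_measurable_sum Y_meas)
  let ?\<mu> = "distr M borel (Y l)" and ?\<nu> = "distr M borel S"
  interpret mu: real_distribution ?\<mu> by simp
  interpret nu: real_distribution ?\<nu> by simp
  have \<mu>: "interval_measure G = ?\<mu>"
    by (rule interval_measure_eq_distr) (use cdf I(3) in auto)
  have nu_cdf: "cdf ?\<nu> s = prob {\<omega> \<in> space M. S \<omega> \<le> s}" for s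
    by (auto simp: cdf_def measure_distr intro!: arg_cong[where f=prob])
  have nu_conv: "cdf ?\<nu> s = conv_pow G (Suc j) s" if "0 \<le> s" for s
    using Suc.IH[OF that] unfolding nu_cdf by (simp only: S_def I_def)
  have nu_neg: "cdf ?\<nu> s = 0" if "s < 0" for s
  proof -
    have "AE \<omega> in M. \<forall>i\<in>I. 0 < Y i \<omega>"
      using I(1) by (intro AE_finite_allI Y_nonneg) (auto simp: I_def)
    then have "AE \<omega> in M. \<not> S \<omega> \<le> s"
    proof eventually_elim
      case (elim \<omega>)
      then have "0 \<le> S \<omega>"
        unfolding S_def by (intro sum_nonneg) auto
      with that show ?case by simp
    qed
    then show ?thesis
      unfolding nu_cdf by (subst prob_Collect_eq_0) auto
  qed
  \<comment> \<open>A distribution function is monotone, hence Borel.\<close>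
  have nu_meas [measurable]: "(\<lambda>x. cdf ?\<nu> (t - x)) \<in> borel_measurable borel"
  proof -
    have "cdf ?\<nu> \<in> borel_measurable borel"
      by (intro borel_measurable_mono monoI nu.cdf_nondecreasing)
    then show ?thesis by measurable
  qed
  have "indep_var borel (Y l) borel S"
    unfolding S_def using I by (intro indep_vars_sum indep_vars_subset[OF ind]) auto
  then have conv: "distr M borel (\<lambda>\<omega>. Y l \<omega> + S \<omega>) = (?\<mu> \<star> ?\<nu>)"
    by (rule sum_indep_random_variable) auto
  have "prob {\<omega> \<in> space M. (\<Sum>i=m+1..m+Suc (Suc j). Y i \<omega>) \<le> t} =
      measure (distr M borel (\<lambda>\<omega>. Y l \<omega> + S \<omega>)) {..t}"
    by (subst measure_distr) (auto simp: S_def I_def l_def add.commute intro!: arg_cong[where f=prob])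
  also have "\<dots> = enn2real (\<integral>\<^sup>+x. emeasure ?\<nu> {a. a + x \<in> {..t}} \<partial>?\<mu>)"
    unfolding conv measure_def
    by (subst convolution_emeasure) (auto simp: mu.finite_measure_axioms nu.finite_measure_axioms)
  also have "(\<integral>\<^sup>+x. emeasure ?\<nu> {a. a + x \<in> {..t}} \<partial>?\<mu>) = (\<integral>\<^sup>+x. ennreal (cdf ?\<nu> (t - x)) \<partial>?\<mu>)"
    by (auto simp: cdf_def nu.emeasure_eq_measure le_diff_eq atMost_def intro!: nn_integral_cong)
  \<comment> \<open>The cut to \<open>{0..t}\<close> is free: almost every \<open>x\<close> is
    positive, and for \<open>x > t\<close> the distribution function of \<open>S\<close> is taken at
    a negative argument, where it vanishes.\<close>
  also have "\<dots> = (\<integral>\<^sup>+x. ennreal (indicator {0..t} x * cdf ?\<nu> (t - x)) \<partial>?\<mu>)"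
  proof (rule nn_integral_cong_AE)
    have "AE x in ?\<mu>. 0 < x"
      using Y_nonneg[OF I(3)] by (subst AE_distr_iff) auto
    then show "AE x in ?\<mu>. ennreal (cdf ?\<nu> (t - x)) = ennreal (indicator {0..t} x * cdf ?\<nu> (t - x))"
      by eventually_elim (auto simp: indicator_def nu_neg)
  qed
  also have "enn2real \<dots> = (\<integral>x. indicator {0..t} x * cdf ?\<nu> (t - x) \<partial>?\<mu>)"
    by (rule integral_eq_nn_integral[symmetric]) (auto simp: nu.cdf_nonneg)
  also have "\<dots> = (LINT s:{0..t}|interval_measure G. conv_pow G (Suc j) (t - s))"
    unfolding \<mu> set_lebesgue_integral_def
    by (intro Bochner_Integration.integral_cong) (auto simp: indicator_def nu_conv simp del: conv_pow.simps)
  finally show ?case by simp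
qed

section \<open>Markov chains on the natural numbers\<close>

text \<open>Events of the natural filtration at step \<open>n\<close>, encoded as predicates on
  whole paths.\<close>

definition depends_upto :: "nat \<Rightarrow> ((nat \<Rightarrow> 'b) \<Rightarrow> bool) \<Rightarrow> bool" where
  "depends_upto n Q \<longleftrightarrow> (\<forall>x x'. (\<forall>i\<le>n. x i = x' i) \<longrightarrow> Q x = Q x')"

lemma depends_uptoD: "depends_upto n Q \<Longrightarrow> (\<And>i. i \<le> n \<Longrightarrow> x i = x' i) \<Longrightarrow> Q x = Q x'"
  unfolding depends_upto_def by blast

lemma depends_upto_mono: "depends_upto n Q \<Longrightarrow> n \<le> m \<Longrightarrow> depends_upto m Q"
  unfolding depends_upto_def by (meson order_trans)

lemma depends_upto_conj:
  "depends_upto n Q \<Longrightarrow> depends_upto n R \<Longrightarrow> depends_upto n (\<lambda>x. Q x \<and> R x)"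
  unfolding depends_upto_def by meson

lemma history_eq_iff:
  "map x [0..<Suc n] = l \<longleftrightarrow> length l = Suc n \<and> (\<forall>i\<le>n. x i = l ! i)"
  by (auto simp: list_eq_iff_nth_eq less_Suc_eq_le simp del: upt_Suc)

lemma measurable_history:
  fixes q :: "nat \<Rightarrow> 'a \<Rightarrow> 'b :: countable"
  assumes [measurable]: "\<And>n. q n \<in> measurable M (count_space UNIV)"
  shows "(\<lambda>\<omega>. map (\<lambda>i. q i \<omega>) [0..<Suc n]) \<in> measurable M (count_space UNIV)"
proof (subst measurable_count_space_eq2_countable, safe)
  fix l :: "'b list"
  have "(\<lambda>\<omega>. map (\<lambda>i. q i \<omega>) [0..<Suc n]) -` {l} \<inter> space M =
      {\<omega> \<in> space M. length l = Suc n \<and> (\<forall>i\<le>n. q i \<omega> = l ! i)}"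
    by (auto simp: history_eq_iff simp del: upt_Suc)
  also have "\<dots> \<in> sets M" by measurable
  finally show "(\<lambda>\<omega>. map (\<lambda>i. q i \<omega>) [0..<Suc n]) -` {l} \<inter> space M \<in> sets M" .
qed auto

lemma depends_upto_sets:
  fixes q :: "nat \<Rightarrow> 'a \<Rightarrow> 'b :: countable"
  assumes "\<And>n. q n \<in> measurable M (count_space UNIV)" and "depends_upto n Q"
  shows "{\<omega> \<in> space M. Q (\<lambda>i. q i \<omega>)} \<in> sets M"
proof -
  let ?h = "\<lambda>\<omega>. map (\<lambda>i. q i \<omega>) [0..<Suc n]"
  \<comment> \<open>The entries of the list beyond \<open>n\<close> are unspecified, but
    \<open>Q\<close> does not see them. Lists over a countable type are countable, so every set of
    them is measurable.\<close>
  have "Q (\<lambda>i. q i \<omega>) \<longleftrightarrow> Q (\<lambda>i. ?h \<omega> ! i)" for \<omega>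
    by (rule depends_uptoD[OF assms(2)]) (simp del: upt_Suc)
  then have "{\<omega> \<in> space M. Q (\<lambda>i. q i \<omega>)} = ?h -` {l. Q (\<lambda>i. l ! i)} \<inter> space M"
    by auto
  also have "\<dots> \<in> sets M"
    by (rule measurable_sets[OF measurable_history[OF assms(1)]]) simp
  finally show ?thesis .
qed

text \<open>Summation over the atoms of \<open>h\<close>, numbered by \<open>to_nat\<close>; numbers
  outside its range give empty atoms.\<close>

lemma (in prob_space) prob_eq_mult_by_countable_partition:
  fixes h :: "'a \<Rightarrow> 'b :: countable"
  assumes h [measurable]: "h \<in> measurable M (count_space UNIV)"
    and [measurable]: "A \<in> events" "B \<in> events"
    and eq: "\<And>c. prob (A \<inter> {\<omega> \<in> space M. h \<omega> = c}) = r * prob (B \<inter> {\<omega> \<in> space M. h \<omega> = c})"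
  shows "prob A = r * prob B"
proof -
  have sums: "(\<lambda>n. prob (E \<inter> {\<omega> \<in> space M. to_nat (h \<omega>) = n})) sums prob E"
    if [measurable]: "E \<in> events" for E
  proof -
    have "(\<lambda>n. prob (E \<inter> {\<omega> \<in> space M. to_nat (h \<omega>) = n})) sums
        prob (\<Union>n. E \<inter> {\<omega> \<in> space M. to_nat (h \<omega>) = n})"
      by (rule finite_measure_UNION) (auto simp: disjoint_family_on_def)
    also have "(\<Union>n. E \<inter> {\<omega> \<in> space M. to_nat (h \<omega>) = n}) = E"
      using sets.sets_into_space[OF that] by auto
    finally show ?thesis .
  qed
  have "prob (A \<inter> {\<omega> \<in> space M. to_nat (h \<omega>) = n}) =
      r * prob (B \<inter> {\<omega> \<in> space M. to_nat (h \<omega>) = n})" for n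
  proof (cases "n \<in> range (to_nat :: 'b \<Rightarrow> nat)")
    case True
    then show ?thesis using eq by auto
  next
    case False
    then have empty: "{\<omega> \<in> space M. to_nat (h \<omega>) = n} = {}" by auto
    show ?thesis unfolding empty by simp
  qed
  then show ?thesis
    using sums_mult[OF sums[of B], of r] sums[of A] by (simp add: sums_iff)
qed

text \<open>Extends the transition rule from single histories to any event of the past: on each
  history \<open>Q\<close> is constantly true or false. The target \<open>g (x n)\<close> may depend
  on the current state, so one lemma serves up and down steps.\<close>

lemma (in prob_space) markov_chain_step:
  assumes mc: "markov_chain_on_nat M q x0 K" and dep: "depends_upto n Q"
    and r: "\<And>x. Q x \<Longrightarrow> K (x n) (g (x n)) = r"
  shows "prob {\<omega> \<in> space M. Q (\<lambda>i. q i \<omega>) \<and> q (Suc n) \<omega> = g (q n \<omega>)} =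
    r * prob {\<omega> \<in> space M. Q (\<lambda>i. q i \<omega>)}"
proof (rule prob_eq_mult_by_countable_partition)
  have q [measurable]: "q i \<in> measurable M (count_space UNIV)" for i
    using mc by (auto simp: markov_chain_on_nat_def)
  let ?h = "\<lambda>\<omega>. map (\<lambda>i. q i \<omega>) [0..<Suc n]"
  show "?h \<in> measurable M (count_space UNIV)"
    by (rule measurable_history) (rule q)
  have [measurable]: "Measurable.pred M (\<lambda>\<omega>. Q (\<lambda>i. q i \<omega>))"
    unfolding pred_def by (rule depends_upto_sets[OF q dep])
  show "{\<omega> \<in> space M. Q (\<lambda>i. q i \<omega>)} \<in> events"
    by measurable
  show "{\<omega> \<in> space M. Q (\<lambda>i. q i \<omega>) \<and> q (Suc n) \<omega> = g (q n \<omega>)} \<in> events"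
    by (rule depends_upto_sets[OF q, of "Suc n"])
      (use dep in \<open>auto simp: depends_upto_def le_Suc_eq all_conj_distrib\<close>)
  fix l :: "nat list"
  define x where "x = (\<lambda>i. l ! i)"
  have Q_iff: "Q (\<lambda>i. q i \<omega>) \<longleftrightarrow> Q x" if "\<forall>i\<le>n. q i \<omega> = l ! i" for \<omega>
    using that by (intro depends_uptoD[OF dep]) (auto simp: x_def)
  show "prob ({\<omega> \<in> space M. Q (\<lambda>i. q i \<omega>) \<and> q (Suc n) \<omega> = g (q n \<omega>)} \<inter> {\<omega> \<in> space M. ?h \<omega> = l}) =
      r * prob ({\<omega> \<in> space M. Q (\<lambda>i. q i \<omega>)} \<inter> {\<omega> \<in> space M. ?h \<omega> = l})"
  proof (cases "length l = Suc n \<and> Q x")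
    case True
    let ?H = "{\<omega> \<in> space M. \<forall>i\<le>n. q i \<omega> = x i}"
    let ?J = "{\<omega> \<in> space M. q (Suc n) \<omega> = g (x n) \<and> (\<forall>i\<le>n. q i \<omega> = x i)}"
    have "prob ?J = r * prob ?H"
    proof (cases "prob ?H > 0")
      case pos: True
      then have "\<P>(\<omega> in M. q (Suc n) \<omega> = g (x n) \<bar> \<forall>i\<le>n. q i \<omega> = x i) = K (x n) (g (x n))"
        using mc unfolding markov_chain_on_nat_def by blast
      with pos r[of x] True show ?thesis
        by (simp add: cond_prob_def field_simps)
    next
      \<comment> \<open>Null histories are not covered by the definition of the chain, but there
        both sides vanish.\<close>
      case False
      then have "prob ?H = 0" by (simp add: zero_less_measure_iff)
      moreover have "prob ?J \<le> prob ?H"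
        by (rule finite_measure_mono) auto
      ultimately show ?thesis
        using measure_nonneg[of M ?J] by simp
    qed
    also have "?J = {\<omega> \<in> space M. Q (\<lambda>i. q i \<omega>) \<and> q (Suc n) \<omega> = g (q n \<omega>)} \<inter> {\<omega> \<in> space M. ?h \<omega> = l}"
      using True Q_iff unfolding history_eq_iff x_def by auto
    also have "?H = {\<omega> \<in> space M. Q (\<lambda>i. q i \<omega>)} \<inter> {\<omega> \<in> space M. ?h \<omega> = l}"
      using True Q_iff unfolding history_eq_iff x_def by auto
    finally show ?thesis .
  next
    case False
    then have "{\<omega> \<in> space M. Q (\<lambda>i. q i \<omega>)} \<inter> {\<omega> \<in> space M. ?h \<omega> = l} = {}"
      using Q_iff unfolding history_eq_iff by auto
    moreover from this
    have "{\<omega> \<in> space M. Q (\<lambda>i. q i \<omega>) \<and> q (Suc n) \<omega> = g (q n \<omega>)} \<inter> {\<omega> \<in> space M. ?h \<omega> = l} = {}"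
      by blast
    ultimately show ?thesis by (metis measure_empty mult_zero_right)
  qed
qed

section \<open>Runs of up steps and service starts along the queue chain\<close>

lemma ups_0 [simp]: "ups m 0 x"
  by (simp add: ups_def)

lemma ups_Suc: "ups m (Suc j) x \<longleftrightarrow> ups m j x \<and> x (Suc (m + j)) = Suc (x (m + j))"
proof -
  have "{m<..m + Suc j} = insert (Suc (m + j)) {m<..m + j}" by auto
  then show ?thesis by (auto simp: ups_def up_def)
qed

lemma ups_value: "ups m j x \<Longrightarrow> x (m + j) = x m + j"
  by (induction j) (auto simp: ups_Suc)

lemma depends_upto_ups: "depends_upto (m + j) (ups m j)"
  unfolding depends_upto_def
proof (intro allI impI)
  fix x x' :: "nat \<Rightarrow> nat" assume "\<forall>i\<le>m + j. x i = x' i"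
  then have "up x i = up x' i" if "i \<in> {m<..m+j}" for i
    using that by (auto simp: up_def)
  then show "ups m j x = ups m j x'" by (simp add: ups_def)
qed

text \<open>The stopping time property of the step at which service starts.\<close>

lemma depends_upto_service_start: "depends_upto m (service_start n m)"
  unfolding depends_upto_def
proof (intro allI impI)
  fix x x' :: "nat \<Rightarrow> nat" assume *: "\<forall>i\<le>m. x i = x' i"
  have "ready x n i = ready x' n i" if "i \<le> m" for i
  proof -
    have "jump_count (up x) i = jump_count (up x') i" "jump_count (down x) i = jump_count (down x') i"
      using * that by (auto intro!: jump_count_cong simp: up_def down_def)
    then show ?thesis by (simp add: ready_def)
  qed
  with * show "service_start n m x = service_start n m x'"
    by (simp add: service_start_def)
qed

locale queue_chain = prob_space M for M :: "'a measure" +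
  fixes q :: "nat \<Rightarrow> 'a \<Rightarrow> nat" and p :: real
  assumes chain: "markov_chain_on_nat M q 0 (queue_kernel p)"
    and p: "0 \<le> p" "p < 1"
begin

abbreviation path :: "'a \<Rightarrow> nat \<Rightarrow> nat" where
  "path \<omega> \<equiv> \<lambda>i. q i \<omega>"

lemma q_measurable [measurable]: "q n \<in> measurable M (count_space UNIV)"
  using chain by (auto simp: markov_chain_on_nat_def)

lemma path_sets:
  assumes "depends_upto n Q"
  shows "{\<omega> \<in> space M. Q (path \<omega>)} \<in> events"
  by (rule depends_upto_sets[OF q_measurable assms])

text \<open>Starting from at least 1 the chain stays there while it goes up, so it never uses the
  exceptional transition at 0 and each step contributes a factor \<open>p\<close>.\<close>

lemma prob_ups:
  assumes dep: "depends_upto m Q" and pos: "\<And>x. Q x \<Longrightarrow> 1 \<le> x m"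
  shows "prob {\<omega> \<in> space M. Q (path \<omega>) \<and> ups m j (path \<omega>)} = p ^ j * prob {\<omega> \<in> space M. Q (path \<omega>)}"
proof (induction j)
  case (Suc j)
  let ?R = "\<lambda>x. Q x \<and> ups m j x"
  have "depends_upto (m + j) ?R"
    using depends_upto_mono[OF dep] depends_upto_ups by (intro depends_upto_conj) auto
  moreover have "queue_kernel p (x (m + j)) (Suc (x (m + j))) = p" if "?R x" for x
    using pos[of x] ups_value[of m j x] that by (simp add: queue_kernel_def)
  ultimately have "prob {\<omega> \<in> space M. ?R (path \<omega>) \<and> q (Suc (m + j)) \<omega> = Suc (q (m + j) \<omega>)} =
      p * prob {\<omega> \<in> space M. ?R (path \<omega>)}"
    by (rule markov_chain_step[OF chain])
  then show ?case
    by (simp add: Suc ups_Suc conj_assoc)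
qed simp

lemma prob_ups_down:
  assumes dep: "depends_upto m Q" and pos: "\<And>x. Q x \<Longrightarrow> 1 \<le> x m"
  shows "prob {\<omega> \<in> space M. Q (path \<omega>) \<and> ups m j (path \<omega>) \<and> down (path \<omega>) (Suc (m + j))} =
    p ^ j * (1 - p) * prob {\<omega> \<in> space M. Q (path \<omega>)}"
proof -
  let ?R = "\<lambda>x. Q x \<and> ups m j x"
  have R: "depends_upto (m + j) ?R"
    using depends_upto_mono[OF dep] depends_upto_ups by (intro depends_upto_conj) auto
  have nonzero: "1 \<le> x (m + j)" if "?R x" for x
    using pos[of x] ups_value[of m j x] that by simp
  have "queue_kernel p (x (m + j)) (x (m + j) - 1) = 1 - p" if "?R x" for x
    using nonzero[OF that] by (simp add: queue_kernel_def)
  then have "prob {\<omega> \<in> space M. ?R (path \<omega>) \<and> q (Suc (m + j)) \<omega> = q (m + j) \<omega> - 1} =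
      (1 - p) * prob {\<omega> \<in> space M. ?R (path \<omega>)}"
    by (rule markov_chain_step[OF chain R])
  \<comment> \<open>Truncated subtraction agrees with \<open>down\<close> here because the state is
    nonzero.\<close>
  also have "{\<omega> \<in> space M. ?R (path \<omega>) \<and> q (Suc (m + j)) \<omega> = q (m + j) \<omega> - 1} =
      {\<omega> \<in> space M. Q (path \<omega>) \<and> ups m j (path \<omega>) \<and> down (path \<omega>) (Suc (m + j))}"
    using nonzero by (force simp: down_Suc)
  also have "prob {\<omega> \<in> space M. ?R (path \<omega>)} = p ^ j * prob {\<omega> \<in> space M. Q (path \<omega>)}"
    by (rule prob_ups[OF dep]) (rule pos)
  finally show ?thesis by simp
qed

text \<open>Transitions with kernel value 0 are null events, and there are countably many of
  them.\<close>

lemma AE_step: "AE \<omega> in M. \<forall>n. up (path \<omega>) (Suc n) \<or> down (path \<omega>) (Suc n)"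
proof -
  have "AE \<omega> in M. q n \<omega> = i \<and> q (Suc n) \<omega> = j \<longrightarrow> j = Suc i \<or> Suc j = i" for n i j
  proof (cases "j = Suc i \<or> Suc j = i")
    case False
    then have "queue_kernel p i j = 0"
      by (auto simp: queue_kernel_def)
    then have "prob {\<omega> \<in> space M. q n \<omega> = i \<and> q (Suc n) \<omega> = j} = 0 * prob {\<omega> \<in> space M. q n \<omega> = i}"
      using markov_chain_step[OF chain, of n "\<lambda>x. x n = i" "\<lambda>_. j" 0] by (simp add: depends_upto_def)
    then have "AE \<omega> in M. \<not> (q n \<omega> = i \<and> q (Suc n) \<omega> = j)"
      by (subst prob_Collect_eq_0[symmetric]) simp_all
    then show ?thesis by (rule eventually_mono) auto
  qed auto
  then have "AE \<omega> in M. \<forall>n i j. q n \<omega> = i \<and> q (Suc n) \<omega> = j \<longrightarrow> j = Suc i \<or> Suc j = i"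
    unfolding AE_all_countable by blast
  then show ?thesis
    by eventually_elim (auto simp: up_Suc down_Suc)
qed

text \<open>An endless run of up steps has probability at most \<open>p ^ j\<close> for every
  \<open>j\<close>, hence zero because \<open>p < 1\<close>.\<close>

lemma AE_not_ups_forever: "AE \<omega> in M. 1 \<le> q m \<omega> \<longrightarrow> (\<exists>j. \<not> ups m j (path \<omega>))"
proof -
  let ?Z = "{\<omega> \<in> space M. 1 \<le> q m \<omega> \<and> (\<forall>j. ups m j (path \<omega>))}"
  have [measurable]: "Measurable.pred M (\<lambda>\<omega>. ups m j (path \<omega>))" for j
    unfolding pred_def by (rule path_sets[OF depends_upto_ups])
  have "prob ?Z \<le> p ^ j" for j
  proof -
    have "prob ?Z \<le> prob {\<omega> \<in> space M. 1 \<le> q m \<omega> \<and> ups m j (path \<omega>)}"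
      by (rule finite_measure_mono) auto
    also have "\<dots> = p ^ j * prob {\<omega> \<in> space M. 1 \<le> q m \<omega>}"
      by (rule prob_ups) (auto simp: depends_upto_def)
    also have "\<dots> \<le> p ^ j * 1"
      using p by (intro mult_left_mono) auto
    finally show ?thesis by simp
  qed
  moreover have "(\<lambda>j. p ^ j) \<longlonglongrightarrow> 0"
    using p by (intro LIMSEQ_realpow_zero) auto
  ultimately have "prob ?Z \<le> 0"
    by (intro LIMSEQ_le_const) auto
  then have "prob ?Z = 0"
    by (simp add: measure_le_0_iff)
  then show ?thesis
    by (subst (asm) prob_Collect_eq_0) (auto elim!: eventually_mono)
qed

lemma AE_excursion_path: "AE \<omega> in M. excursion_path (path \<omega>)"
proof -
  have "AE \<omega> in M. q 0 \<omega> = 0"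
    using chain by (auto simp: markov_chain_on_nat_def)
  moreover have "AE \<omega> in M. \<forall>m. 1 \<le> q m \<omega> \<longrightarrow> (\<exists>j. \<not> ups m j (path \<omega>))"
    using AE_not_ups_forever by (simp add: AE_all_countable)
  ultimately show ?thesis
    using AE_step
  proof eventually_elim
    case (elim \<omega>)
    show ?case
    proof
      fix m
      show "\<exists>i>m. down (path \<omega>) i"
      proof (rule ccontr)
        assume "\<not> (\<exists>i>m. down (path \<omega>) i)"
        then have up: "up (path \<omega>) i" if "m < i" for i
          using that elim(3)[rule_format, of "i - 1"] by auto
        \<comment> \<open>The run is taken from \<open>Suc m\<close>, since \<open>q m\<close> may
          be 0 whereas the state after an up step is not.\<close>
        then have "1 \<le> q (Suc m) \<omega>"
          using up[of "Suc m"] by (simp add: up_Suc)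
        moreover have "ups (Suc m) j (path \<omega>)" for j
          using up by (auto simp: ups_def)
        ultimately show False
          using elim(2) by blast
      qed
    qed (use elim in auto)
  qed
qed

lemma sums_prob_service_start:
  "(\<lambda>m. prob {\<omega> \<in> space M. service_start n m (path \<omega>)}) sums 1"
proof -
  let ?E = "\<lambda>m. {\<omega> \<in> space M. service_start n m (path \<omega>)}"
  have "(\<lambda>m. prob (?E m)) sums prob (\<Union>m. ?E m)"
  proof (rule finite_measure_UNION)
    show "range ?E \<subseteq> events"
      using path_sets[OF depends_upto_service_start] by auto
    show "disjoint_family ?E"
      unfolding disjoint_family_on_def service_start_def
      by (auto dest: linorder_neqE_nat)
  qed
  also have "prob (\<Union>m. ?E m) = 1"
  proof (subst prob_eq_1)
    show "(\<Union>m. ?E m) \<in> events"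
      using path_sets[OF depends_upto_service_start] by auto
    show "AE \<omega> in M. \<omega> \<in> (\<Union>m. ?E m)"
      using AE_excursion_path AE_space
      by eventually_elim (use excursion_path.service_period_exists in blast)
  qed
  finally show ?thesis .
qed

end

section \<open>The service time distribution\<close>

text \<open>A general step distribution \<open>G\<close>: the Mittag-Leffler form matters only
  through \<open>G 0 = 0\<close> and \<open>p < 1\<close>.\<close>

locale renewal_queue = queue_chain M q p for M :: "'a measure" and q p +
  fixes Y :: "nat \<Rightarrow> 'a \<Rightarrow> real" and G :: "real \<Rightarrow> real"
  assumes iid: "iid_with_cdf M Y G"
    and G_0: "G 0 = 0"
    and indep: "indep_processes M q Y"
begin

lemma Y_measurable: "1 \<le> i \<Longrightarrow> Y i \<in> borel_measurable M"
  using iid by (auto simp: iid_with_cdf_def indep_vars_def)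

lemma Y_cdf: "1 \<le> i \<Longrightarrow> prob {\<omega> \<in> space M. Y i \<omega> \<le> t} = G t"
  using iid by (auto simp: iid_with_cdf_def)

lemma block_sets: "{\<omega> \<in> space M. (\<Sum>i=m+1..m+Suc j. Y i \<omega>) > t} \<in> events"
proof -
  have [measurable]: "(\<lambda>\<omega>. \<Sum>i=m+1..m+Suc j. Y i \<omega>) \<in> borel_measurable M"
    by (intro borel_measurable_sum Y_measurable) auto
  show ?thesis by measurable
qed

lemma AE_positive_steps: "AE \<omega> in M. positive_steps (\<lambda>i. Y i \<omega>)"
proof -
  have "AE \<omega> in M. 1 \<le> i \<longrightarrow> 0 < Y i \<omega>" for i
  proof (cases "1 \<le> i")
    case True
    then show ?thesis
      using prob_Collect_eq_0[of "\<lambda>\<omega>. Y i \<omega> \<le> 0"] Y_cdf[OF True, of 0] Y_measurable[OF True]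
      by (simp add: G_0 not_le)
  qed simp
  then have "AE \<omega> in M. \<forall>i. 1 \<le> i \<longrightarrow> 0 < Y i \<omega>"
    by (simp add: AE_all_countable)
  then show ?thesis
    by eventually_elim (simp add: positive_steps_def)
qed

text \<open>The path event and the block event lie in the sigma-algebras generated by the two
  processes, so independence factorises the probability.\<close>

lemma prob_path_block:
  assumes dep: "depends_upto k Q" and "0 \<le> t"
  shows "prob ({\<omega> \<in> space M. Q (path \<omega>)} \<inter> {\<omega> \<in> space M. (\<Sum>i=m+1..m+Suc j. Y i \<omega>) > t}) =
    prob {\<omega> \<in> space M. Q (path \<omega>)} * (1 - conv_pow G (Suc j) t)"
proof -
  let ?V = "vimage_algebra (space M) (\<lambda>\<omega> k. q k \<omega>) (PiM UNIV (\<lambda>_. count_space UNIV))"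
  let ?W = "vimage_algebra (space M) (\<lambda>\<omega>. \<lambda>k\<in>{1..}. Y k \<omega>) (PiM {1..} (\<lambda>_. borel))"
  let ?A = "{\<omega> \<in> space M. Q (path \<omega>)}" and ?B = "{\<omega> \<in> space M. (\<Sum>i=m+1..m+Suc j. Y i \<omega>) > t}"
  have V: "q i \<in> measurable ?V (count_space UNIV)" for i
  proof -
    have "(\<lambda>\<omega> k. q k \<omega>) \<in> measurable ?V (PiM UNIV (\<lambda>_. count_space UNIV))"
      by (rule measurable_vimage_algebra1) (auto simp: space_PiM)
    from measurable_compose[OF this measurable_component_singleton[of i]] show ?thesis by simp
  qed
  have W: "Y i \<in> borel_measurable ?W" if "1 \<le> i" for i
  proof -
    have "(\<lambda>\<omega>. \<lambda>k\<in>{1..}. Y k \<omega>) \<in> measurable ?W (PiM {1..} (\<lambda>_. borel))"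
      by (rule measurable_vimage_algebra1) (auto simp: space_PiM)
    from measurable_compose[OF this measurable_component_singleton[of i]] that show ?thesis by simp
  qed
  have [measurable]: "(\<lambda>\<omega>. \<Sum>i=m+1..m+Suc j. Y i \<omega>) \<in> borel_measurable ?W"
    by (intro borel_measurable_sum W) auto
  have "?A \<in> sets ?V"
    using depends_upto_sets[OF V dep] by simp
  moreover have "?B \<in> sets ?W"
  proof -
    have "{\<omega> \<in> space ?W. (\<Sum>i=m+1..m+Suc j. Y i \<omega>) > t} \<in> sets ?W" by measurable
    then show ?thesis by simp
  qed
  ultimately have "prob (?A \<inter> ?B) = prob ?A * prob ?B"
    using indep unfolding indep_processes_def by (intro indep_setD)
  also have "prob ?B = 1 - prob {\<omega> \<in> space M. \<not> (\<Sum>i=m+1..m+Suc j. Y i \<omega>) > t}"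
    using prob_neg[OF block_sets[where m=m and j=j and t=t]] by simp
  also have "prob {\<omega> \<in> space M. \<not> (\<Sum>i=m+1..m+Suc j. Y i \<omega>) > t} = conv_pow G (Suc j) t"
    using prob_sum_le_eq_conv_pow[where Y=Y and G=G and t=t and j=j and m=m] iid Y_cdf G_0 \<open>0 \<le> t\<close>
    by (simp add: not_less iid_with_cdf_def del: conv_pow.simps)
  finally show ?thesis .
qed

text \<open>A cell of the event that the service of customer \<open>n + 1\<close> lasts longer than
  \<open>t\<close>, indexed by the number \<open>j\<close> of up steps during service and the
  starting step \<open>m\<close>.\<close>

definition long_service :: "nat \<Rightarrow> real \<Rightarrow> nat \<Rightarrow> nat \<Rightarrow> 'a set" where
  "long_service n t j m =
    {\<omega> \<in> space M. service_start n m (path \<omega>) \<and> ups m j (path \<omega>) \<and> down (path \<omega>) (Suc (m + j))} \<inter>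
    {\<omega> \<in> space M. (\<Sum>i=m+1..m+Suc j. Y i \<omega>) > t}"

lemma depends_upto_service:
  "depends_upto (Suc (m + j)) (\<lambda>x. service_start n m x \<and> ups m j x \<and> down x (Suc (m + j)))"
proof (intro depends_upto_conj)
  show "depends_upto (Suc (m + j)) (service_start n m)"
    using depends_upto_service_start by (rule depends_upto_mono) simp
  show "depends_upto (Suc (m + j)) (ups m j)"
    using depends_upto_ups by (rule depends_upto_mono) simp
  show "depends_upto (Suc (m + j)) (\<lambda>x. down x (Suc (m + j)))"
    by (simp add: depends_upto_def down_Suc)
qed

lemma long_service_sets: "long_service n t j m \<in> events"
  unfolding long_service_def by (intro sets.Int block_sets path_sets[OF depends_upto_service])

lemma prob_long_service:
  assumes "0 \<le> t"
  shows "prob (long_service n t j m) = (1 - conv_pow G (Suc j) t) * p ^ j * (1 - p) *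
    prob {\<omega> \<in> space M. service_start n m (path \<omega>)}"
  unfolding long_service_def prob_path_block[OF depends_upto_service assms]
  by (subst prob_ups_down[OF depends_upto_service_start])
     (auto simp: service_start_def simp del: conv_pow.simps)

text \<open>Two different values of \<open>j\<close> would make the closing down step of the shorter
  run an up step of the longer one.\<close>

lemma long_service_unique:
  assumes "\<omega> \<in> long_service n t j m" "\<omega> \<in> long_service n t j' m'"
  shows "j = j' \<and> m = m'"
proof
  show m: "m = m'"
    using assms unfolding long_service_def service_start_def by (auto dest: linorder_neqE_nat)
  have False if "i < i'" "down (path \<omega>) (Suc (m + i))" "ups m i' (path \<omega>)" for i i'
  proof -
    have "up (path \<omega>) (Suc (m + i))"
      using that by (auto simp: ups_def)
    with that(2) show False by (simp add: up_Suc down_Suc)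
  qed
  with assms m show "j = j'"
    unfolding long_service_def by (metis (no_types, lifting) Int_iff linorder_neqE_nat mem_Collect_eq)
qed

text \<open>For fixed \<open>j\<close> the sum over \<open>m\<close> comes first: the starting
  probabilities add up to 1, so \<open>m\<close> disappears and the geometric weights
  remain.\<close>

lemma sums_prob_long_service:
  assumes "0 \<le> t"
  shows "(\<lambda>j. (1 - conv_pow G (Suc j) t) * p ^ j * (1 - p)) sums prob (\<Union>j m. long_service n t j m)"
proof -
  have "prob (\<Union>m. long_service n t j m) = (1 - conv_pow G (Suc j) t) * p ^ j * (1 - p)" for j
  proof -
    have "(\<lambda>m. prob (long_service n t j m)) sums prob (\<Union>m. long_service n t j m)"
      using long_service_sets long_service_unique
      by (intro finite_measure_UNION) (fastforce simp: disjoint_family_on_def)+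
    moreover have "(\<lambda>m. prob (long_service n t j m)) sums ((1 - conv_pow G (Suc j) t) * p ^ j * (1 - p) * 1)"
      unfolding prob_long_service[OF assms] by (rule sums_mult[OF sums_prob_service_start])
    ultimately show ?thesis
      using sums_unique2 by fastforce
  qed
  moreover have "(\<lambda>j. prob (\<Union>m. long_service n t j m)) sums prob (\<Union>j m. long_service n t j m)"
    using long_service_sets long_service_unique
    by (intro finite_measure_UNION) (fastforce simp: disjoint_family_on_def)+
  ultimately show ?thesis by simp
qed

lemma AE_service_time_exceeds:
  "AE \<omega> in M. \<omega> \<in> (\<Union>j m. long_service n t j m) \<longleftrightarrow> \<omega> \<in> service_time_exceeds M q Y (Suc n) t"
  using AE_excursion_path AE_positive_steps AE_space
proof eventually_elim
  case (elim \<omega>)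
  interpret excursion_path "path \<omega>" by fact
  note eq = service_time_eq[OF elim(2)]
  obtain m j where mj: "service_start n m (path \<omega>)" "ups m j (path \<omega>)" "down (path \<omega>) (Suc (m + j))"
    using service_period_exists by blast
  show ?case
  proof
    assume "\<omega> \<in> (\<Union>j m. long_service n t j m)"
    then show "\<omega> \<in> service_time_exceeds M q Y (Suc n) t"
      using eq elim(3) by (fastforce simp: long_service_def service_time_exceeds_def)
  next
    assume "\<omega> \<in> service_time_exceeds M q Y (Suc n) t"
    then have "\<omega> \<in> long_service n t j m"
      using eq[OF mj] mj by (simp add: long_service_def service_time_exceeds_def)
    then show "\<omega> \<in> (\<Union>j m. long_service n t j m)" by blast
  qed
qed

text \<open>The event differs from the measurable union of cells only by a null set, so it is
  measurable in the completion and has the same probability.\<close>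

theorem service_time_tail:
  assumes "0 \<le> t"
  shows "(\<lambda>j. (1 - conv_pow G (Suc j) t) * p ^ j * (1 - p))
    sums measure (completion M) (service_time_exceeds M q Y (Suc n) t)"
proof -
  let ?H = "\<Union>j m. long_service n t j m" and ?S = "service_time_exceeds M q Y (Suc n) t"
  have H: "?H \<in> events"
    using long_service_sets by blast
  have ae: "AE \<omega> in completion M. \<omega> \<in> ?H \<longleftrightarrow> \<omega> \<in> ?S"
    using AE_service_time_exceeds by (rule AE_completion)
  have "?S \<in> sets (completion M)"
    by (rule completion.in_sets_AE[OF ae])
       (use H in \<open>auto simp: service_time_exceeds_def\<close>)
  then have "measure (completion M) ?S = measure (completion M) ?H"
    using H ae by (intro measure_eq_AE) auto
  then show ?thesis
    using H sums_prob_long_service[OF assms] by simp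
qed

end

theorem theorem2p3:
  fixes \<alpha> \<beta> lam \<mu> p t :: real and k :: nat
    and N :: "'b measure" and X1 X2 :: "'b \<Rightarrow> real"
    and M :: "'a measure" and q :: "nat \<Rightarrow> 'a \<Rightarrow> nat" and Y :: "nat \<Rightarrow> 'a \<Rightarrow> real"
  assumes "\<alpha> \<in> {0<..1}" and "\<beta> \<in> {0<..1}" and "lam > 0" and "\<mu> > 0"
    and "prob_space N"
    and "mittag_leffler_distributed N X1 \<alpha> lam" and "mittag_leffler_distributed N X2 \<beta> \<mu>"
    and "prob_space.indep_var N borel X1 borel X2"
    and "p = measure N {\<omega> \<in> space N. X1 \<omega> < X2 \<omega>}"
    and "prob_space M"
    and "markov_chain_on_nat M q 0 (queue_kernel p)"
    and "iid_with_cdf M Y (min_mittag_leffler_cdf \<alpha> \<beta> lam \<mu>)"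
    and "indep_processes M q Y"
    and "k \<ge> 1" and "t > 0"
  shows "(\<lambda>j. (1 - conv_pow (min_mittag_leffler_cdf \<alpha> \<beta> lam \<mu>) (j + 1) t) * p ^ j * (1 - p))
           sums measure (completion M) (service_time_exceeds M q Y k t)"
proof -
  \<comment> \<open>Independence and the laws of \<open>X1\<close> and \<open>X2\<close> enter only
    here.\<close>
  have "p < 1"
    unfolding assms(9) using assms(1-8) by (intro mittag_leffler_less_prob) auto
  \<comment> \<open>\<open>G 0 = 0\<close> holds because \<open>0 powr \<alpha> = 0\<close> and the
    Mittag-Leffler function is 1 at 0.\<close>
  then interpret renewal_queue M q p Y "min_mittag_leffler_cdf \<alpha> \<beta> lam \<mu>"
    using assms
    by (auto simp: renewal_queue_def queue_chain_def queue_chain_axioms_def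
        renewal_queue_axioms_def min_mittag_leffler_cdf_def)
  obtain n where "k = Suc n"
    using \<open>k \<ge> 1\<close> by (cases k) auto
  then show ?thesis
    using service_time_tail[of t n] \<open>t > 0\<close> by (simp del: conv_pow.simps)
qed

end
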